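(* Let $s>0$. Suppose that $\delta>0$ is sufficiently small in the sense that the Zarantonello mapping is a contraction with constant $0<q_{\rm sym}<1$ (see context), that the error estimator satisfies (A1)--(A3), that $\lambda_{\rm alg}^\star>0$ (depending only on $q_{\rm alg}$ and $q_{\rm sym}$) is chosen such that $$0<\frac{q_{\rm sym}+2\,\frac{q_{\rm alg}}{1-q_{\rm alg}}\,\lambda_{\rm alg}^\star}{1-2\,\frac{q_{\rm alg}}{1-q_{\rm alg}}\,\lambda_{\rm alg}^\star}<1 ,$$ and that $0<\theta\le1$, $0<\lambda_{\rm sym}\le1$, and $0<\lambda_{\rm alg}\le\lambda_{\rm alg}'$, where $0<\lambda_{\rm alg}'\le\lambda_{\rm alg}^\star$ is a threshold ensuring full linear convergence, with associated $C_{\rm lin}>0$, $0<q_{\rm lin}<1$ and $\ell_0\in\mathbb N_0$, $\ell_0\le\underline\ell$ (see context). Then the output of the AISFEM algorithm guarantees that $$M(s):=\sup_{\substack{(\ell,k,j)\in\mathcal Q\\ \ell\ge\ell_0}}(\#\mathcal T_\ell)^s\,\Delta_\ell^{k,j}\le\sup_{\substack{(\ell,k,j)\in\mathcal Q\\ \ell\ge\ell_0}}\Bigl(\sum_{\substack{(\ell',k',j')\in\mathcal Q\\ |\ell',k',j'|\le|\ell,k,j|\\ \ell'\ge\ell_0}}\#\mathcal T_{\ell'}\Bigr)^s\Delta_\ell^{k,j}\le\frac{C_{\rm lin}}{(1-q_{\rm lin}^{1/s})^s}\,M(s).$$ This yields the equivalence $$\sup_{(\ell,k,j)\in\mathcal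 Q}(\#\mathcal T_\ell)^s\,\Delta_\ell^{k,j}<\infty\quad\Longleftrightarrow\quad\sup_{(\ell,k,j)\in\mathcal Q}\Bigl(\sum_{\substack{(\ell',k',j')\in\mathcal Q\\ |\ell',k',j'|\le|\ell,k,j|}}\#\mathcal T_{\ell'}\Bigr)^s\Delta_\ell^{k,j}<\infty.$$
   Context: **Model problem.** $\Omega\subset\mathbb R^d$, $d\ge1$, is a polyhedral Lipschitz domain; $\boldsymbol A\in[L^\infty(\Omega)]^{d\times d}$ is symmetric, $\boldsymbol b\in[L^\infty(\Omega)]^d$, $c\in L^\infty(\Omega)$, $f\in L^2(\Omega)$, $\boldsymbol f\in[L^2(\Omega)]^d$. Let $\mathcal X:=H_0^1(\Omega)$ with dual $\mathcal X'$, $\langle\cdot,\cdot\rangle_\Omega$ the $L^2(\Omega)$ scalar product, $a(u,v):=\langle\boldsymbol A\nabla u,\nabla v\rangle_\Omega$, $\langle\mathcal Ku,v\rangle:=\langle\boldsymbol b\cdot\nabla u+cu,v\rangle_\Omega$ (a compact operator $\mathcal K:\mathcal X\to\mathcal X'$), $b(u,v):=a(u,v)+\langle\mathcal Ku,v\rangle$, $F(v):=\langle f,v\rangle_\Omega+\langle\boldsymbol f,\nabla v\rangle_\Omega$. Standing assumption: $b(\cdot,\cdot)$ is continuous and elliptic on $\mathcal X$. Then $a(\cdot,\cdot)$ is a scalar product on $\mathcal X$ whose energy norm $\|v\|_a:=a(v,v)^{1/2}$ is equivalent to the $H^1_0$ norm, and there are constants $0<\alpha\le L<\infty$ with $\alpha\|u\|_a^2\le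 b(u,u)$ and $|b(u,v)|\le L\|u\|_a\|v\|_a$ for all $u,v\in\mathcal X$. The exact solution $u^\star\in\mathcal X$ satisfies $b(u^\star,v)=F(v)$ for all $v\in\mathcal X$. **Meshes and discrete spaces.** $\mathcal T_0$ is a conforming simplicial triangulation of $\Omega$ (admissible in the sense of Stevenson 2008 if $d\ge3$). Refinement uses newest vertex bisection (NVB): $\mathtt{refine}(\mathcal T_H,\mathcal M_H)$ is the coarsest conforming NVB refinement of $\mathcal T_H$ in which all elements of $\mathcal M_H\subseteq\mathcal T_H$ are refined. $\mathbb T(\mathcal T_H)$ is the set of all triangulations obtained from $\mathcal T_H$ by finitely many refinement steps; $\mathbb T:=\mathbb T(\mathcal T_0)$. For a fixed polynomial degree $m\in\mathbb N$ and $\mathcal T_H\in\mathbb T$, $\mathcal X_H:=\{v\in H_0^1(\Omega): v|_T\text{ is a polynomial of degree}\le m\ \forall T\in\mathcal T_H\}$, and $u_H^\star\in\mathcal X_H$ is the Galerkin solution: $b(u_H^\star,v_H)=F(v_H)$ for all $v_H\in\mathcal X_H$. Objects related to $\mathcal T_\ell$ carry the index $\ell$. **Error estimator.** For $\mathcal T_H\in\mathbb T$ and $T\in\mathcal T_H$, $\eta_H(T;\cdot):\mathcal X_H\to\mathbb R_{\ge0}$ are the local contributions of a computable estimator; $\eta_H(\mathcal U_H;v_H):=(\sum_{T\in\mathcal U_H}\eta_H(T;v_H)^2)^{1/2}$ for $\mathcal U_H\subseteq\mathcal T_H$, $\eta_H(v_H):=\eta_H(\mathcal T_H;v_H)$.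 Axioms, with constants $C_{\rm stab},C_{\rm rel}>0$, $0<q_{\rm red}<1$ depending only on $d$, $m$, and shape regularity of $\mathcal T_0$, for all $\mathcal T_H\in\mathbb T$ and $\mathcal T_h\in\mathbb T(\mathcal T_H)$: (A1) stability: $|\eta_h(\mathcal U_H;v_h)-\eta_H(\mathcal U_H;v_H)|\le C_{\rm stab}\|v_h-v_H\|_a$ for all $v_h\in\mathcal X_h$, $v_H\in\mathcal X_H$, $\mathcal U_H\subseteq\mathcal T_H\cap\mathcal T_h$. (A2) reduction: $\eta_h(\mathcal T_h\setminus\mathcal T_H;v_H)\le q_{\rm red}\,\eta_H(\mathcal T_H\setminus\mathcal T_h;v_H)$ for all $v_H\in\mathcal X_H$. (A3) reliability: $\|u^\star-u_H^\star\|_a\le C_{\rm rel}\,\eta_H(u_H^\star)$. **Zarantonello mapping.** For $\delta>0$, $\Phi_H(\delta;\cdot):\mathcal X_H\to\mathcal X_H$ is defined by $a(\Phi_H(\delta;u_H),v_H)=a(u_H,v_H)+\delta[F(v_H)-b(u_H,v_H)]$ for all $v_H\in\mathcal X_H$. For $0<\delta<2\alpha/L^2$ it is a contraction: there is $0<q_{\rm sym}<1$, independent of $\mathcal T_H$, with $\|\Phi_H(\delta;u_H)-\Phi_H(\delta;w_H)\|_a\le q_{\rm sym}\|u_H-w_H\|_a$ for all $u_H,w_H\in\mathcal X_H$. "$\delta$ sufficiently small" means that this holds. **Algebraic solver.** For each $\mathcal T_H\in\mathbb T$ there is an iteration map $\Psi_H:\mathcal X'\times\mathcal X_H\to\mathcal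 X_H$ and a constant $0<q_{\rm alg}<1$ independent of $G$ and $\mathcal X_H$ such that, for $G\in\mathcal X'$ and $w_H^\star\in\mathcal X_H$ with $a(w_H^\star,v_H)=G(v_H)$ for all $v_H\in\mathcal X_H$, $\|w_H^\star-\Psi_H(G;w_H)\|_a\le q_{\rm alg}\|w_H^\star-w_H\|_a$ for all $w_H\in\mathcal X_H$. **AISFEM algorithm.** Input: $\mathcal T_0$, $u_0^{0,0}:=u_0^{0,\underline j}:=u_0^{0,\star}:=0$, $0<\theta\le1$, $C_{\rm mark}\ge1$, $\lambda_{\rm sym},\lambda_{\rm alg}>0$, $\delta>0$. For $\ell=0,1,2,\dots$ repeat (i)--(iv): (i) For $k=1,2,3,\dots$ repeat (a)--(d): (a) $u_\ell^{k,0}:=u_\ell^{k-1,\underline j}$ and (for theoretical reasons only) $u_\ell^{k,\star}:=\Phi_\ell(\delta;u_\ell^{k-1,\underline j})$. (b) For $j=1,2,3,\dots$: (I) compute $u_\ell^{k,j}:=\Psi_\ell(G_\ell^k;u_\ell^{k,j-1})$ with $G_\ell^k(v):=a(u_\ell^{k-1,\underline j},v)+\delta[F(v)-b(u_\ell^{k-1,\underline j},v)]$, and $\eta_\ell(T;u_\ell^{k,j})$ for all $T\in\mathcal T_\ell$; (II) terminate the $j$-loop if $\|u_\ell^{k,j}-u_\ell^{k,j-1}\|_a\le\lambda_{\rm alg}[\lambda_{\rm sym}\eta_\ell(u_\ell^{k,j})+\|u_\ell^{k,j}-u_\ell^{k-1,\underline j}\|_a]$. (c) Set $\underline j[\ell,k]:=j$.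 (d) Terminate the $k$-loop if $\|u_\ell^{k,\underline j}-u_\ell^{k-1,\underline j}\|_a\le\lambda_{\rm sym}\eta_\ell(u_\ell^{k,\underline j})$. (ii) Set $\underline k[\ell]:=k$. (iii) Determine $\mathcal M_\ell\subseteq\mathcal T_\ell$ with $\theta\,\eta_\ell(u_\ell^{\underline k,\underline j})^2\le\eta_\ell(\mathcal M_\ell;u_\ell^{\underline k,\underline j})^2$ whose cardinality is minimal among all such sets up to the factor $C_{\rm mark}$. (iv) $\mathcal T_{\ell+1}:=\mathtt{refine}(\mathcal T_\ell,\mathcal M_\ell)$ and $u_{\ell+1}^{0,0}:=u_{\ell+1}^{0,\underline j}:=u_{\ell+1}^{0,\star}:=u_\ell^{\underline k,\underline j}$. Arguments of $\underline k,\underline j$ are omitted when clear, e.g. $u_\ell^{k,\underline j}:=u_\ell^{k,\underline j[\ell,k]}$, $u_\ell^{\underline k,\underline j}:=u_\ell^{\underline k[\ell],\underline j[\ell,\underline k[\ell]]}$. **Index set.** $\mathcal Q:=\{(\ell,k,j)\in\mathbb N_0^3: u_\ell^{k,j}\text{ is used in the algorithm}\}$ (which runs without overall stopping, so $\#\mathcal Q=\infty$), $\underline\ell:=\sup\{\ell:(\ell,0,0)\in\mathcal Q\}$, $\underline k[\ell]:=\sup\{k:(\ell,k,0)\in\mathcal Q\}$, $\underline j[\ell,k]:=\sup\{j:(\ell,k,j)\in\mathcal Q\}$, all in $\mathbb N_0\cup\{\infty\}$. $\mathcal Q$ is totally ordered lexicographically (i.e., by the order of computation in the algorithm), and $|\ell,k,j|:=\#\{(\ell',k',j')\in\mathcal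 Q:(\ell',k',j')\le(\ell,k,j)\}$. **Quasi-error and full linear convergence.** $\Delta_\ell^{k,j}:=\|u^\star-u_\ell^{k,j}\|_a+\|u_\ell^{k,\star}-u_\ell^{k,j}\|_a+\eta_\ell(u_\ell^{k,j})$ for $(\ell,k,j)\in\mathcal Q$. Given $\theta$ and $\lambda_{\rm sym}$, the threshold $0<\lambda_{\rm alg}'\le\lambda_{\rm alg}^\star$ is such that for every $0<\lambda_{\rm alg}\le\lambda_{\rm alg}'$ there are $C_{\rm lin}>0$, $0<q_{\rm lin}<1$ and $\ell_0\in\mathbb N_0$ with $\ell_0\le\underline\ell$ such that $\Delta_\ell^{k,j}\le C_{\rm lin}\,q_{\rm lin}^{|\ell,k,j|-|\ell',k',j'|}\,\Delta_{\ell'}^{k',j'}$ for all $(\ell,k,j),(\ell',k',j')\in\mathcal Q$ with $|\ell,k,j|>|\ell',k',j'|$ and $\ell'\ge\ell_0$ (the paper's full linear convergence theorem provides such a threshold). *)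

theory Defs
  imports "HOL-Analysis.Analysis" "HOL-Library.Extended_Nat"
begin

section \<open>Domains\<close>

type_synonym 'n fn = "real^'n \<Rightarrow> real"
type_synonym 'n vfn = "real^'n \<Rightarrow> real^'n"

text \<open>Near each boundary point the domain is the strict subgraph, in a unit direction \<open>e\<close>, of a
  Lipschitz function on the hyperplane orthogonal to \<open>e\<close> (a single point if the dimension is 1).
  That the boundary is the graph itself follows by continuity.\<close>

definition lipschitz_boundary :: "(real^'n::finite) set \<Rightarrow> bool" where
  "lipschitz_boundary \<Omega> \<longleftrightarrow>
     (\<forall>x\<in>frontier \<Omega>. \<exists>e r L \<phi>. norm e = 1 \<and> 0 < r \<and> L-lipschitz_on {z. z \<bullet> e = 0} (\<phi> :: real^'n \<Rightarrow> real) \<and>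
        \<Omega> \<inter> ball x r =
          {y \<in> ball x r. (y - x) \<bullet> e < \<phi> ((y - x) - ((y - x) \<bullet> e) *\<^sub>R e)})"

definition polyhedral_lipschitz_domain :: "(real^'n::finite) set \<Rightarrow> bool" where
  "polyhedral_lipschitz_domain \<Omega> \<longleftrightarrow>
     open \<Omega> \<and> connected \<Omega> \<and> bounded \<Omega> \<and> \<Omega> \<noteq> {} \<and> lipschitz_boundary \<Omega> \<and>
     (\<exists>\<P>. finite \<P> \<and> (\<forall>p\<in>\<P>. polytope p) \<and> closure \<Omega> = \<Union>\<P>)"


section \<open>Lebesgue and Sobolev spaces\<close>

text \<open>Elements of these spaces are represented by functions; all notions below depend only on the
  values almost everywhere on \<open>\<Omega>\<close>, so equality in the spaces is equality almost everywhere.\<close>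

definition L2_fun :: "(real^'n::finite) set \<Rightarrow> 'n fn set" where
  "L2_fun \<Omega> = {u \<in> borel_measurable (lebesgue_on \<Omega>). integrable (lebesgue_on \<Omega>) (\<lambda>x. (u x)\<^sup>2)}"

definition L2_vec :: "(real^'n::finite) set \<Rightarrow> 'n vfn set" where
  "L2_vec \<Omega> = {g. \<forall>i. (\<lambda>x. g x $ i) \<in> L2_fun \<Omega>}"

definition Linf_fun :: "(real^'n::finite) set \<Rightarrow> 'n fn set" where
  "Linf_fun \<Omega> = {u \<in> borel_measurable (lebesgue_on \<Omega>). \<exists>C. AE x in lebesgue_on \<Omega>. \<bar>u x\<bar> \<le> C}"

definition partial_deriv :: "'n::finite \<Rightarrow> 'n fn \<Rightarrow> 'n fn" where
  "partial_deriv i \<phi> x = frechet_derivative \<phi> (at x) (axis i 1)"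

primrec iterated_partial :: "'n::finite list \<Rightarrow> 'n fn \<Rightarrow> 'n fn" where
  "iterated_partial [] \<phi> = \<phi>"
| "iterated_partial (i # is) \<phi> = partial_deriv i (iterated_partial is \<phi>)"

definition test_function :: "(real^'n::finite) set \<Rightarrow> 'n fn \<Rightarrow> bool" where
  "test_function \<Omega> \<phi> \<longleftrightarrow> (\<forall>is x. iterated_partial is \<phi> differentiable (at x)) \<and>
     (\<exists>K. compact K \<and> K \<subseteq> \<Omega> \<and> (\<forall>x. x \<notin> K \<longrightarrow> \<phi> x = 0))"

definition weak_gradient :: "(real^'n::finite) set \<Rightarrow> 'n fn \<Rightarrow> 'n vfn \<Rightarrow> bool" where
  "weak_gradient \<Omega> u g \<longleftrightarrow> g \<in> L2_vec \<Omega> \<and>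
     (\<forall>\<phi> i. test_function \<Omega> \<phi> \<longrightarrow>
        (LINT x|lebesgue_on \<Omega>. u x * partial_deriv i \<phi> x) = - (LINT x|lebesgue_on \<Omega>. g x $ i * \<phi> x))"

definition wgrad :: "(real^'n::finite) set \<Rightarrow> 'n fn \<Rightarrow> 'n vfn" where
  "wgrad \<Omega> u = (SOME g. weak_gradient \<Omega> u g)"

definition H1 :: "(real^'n::finite) set \<Rightarrow> 'n fn set" where
  "H1 \<Omega> = {u \<in> L2_fun \<Omega>. \<exists>g. weak_gradient \<Omega> u g}"

definition H1_norm :: "(real^'n::finite) set \<Rightarrow> 'n fn \<Rightarrow> real" where
  "H1_norm \<Omega> u = sqrt ((LINT x|lebesgue_on \<Omega>. (u x)\<^sup>2) + (LINT x|lebesgue_on \<Omega>. (norm (wgrad \<Omega> u x))\<^sup>2))"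

definition H10 :: "(real^'n::finite) set \<Rightarrow> 'n fn set" where
  "H10 \<Omega> = {u \<in> H1 \<Omega>. \<exists>\<phi>. (\<forall>n::nat. test_function \<Omega> (\<phi> n)) \<and> (\<lambda>n. H1_norm \<Omega> (\<phi> n - u)) \<longlonglongrightarrow> 0}"

definition dual_H10 :: "(real^'n::finite) set \<Rightarrow> ('n fn \<Rightarrow> real) set" where
  "dual_H10 \<Omega> = {G. (\<forall>u\<in>H10 \<Omega>. \<forall>v\<in>H10 \<Omega>. \<forall>s t. G (\<lambda>x. s * u x + t * v x) = s * G u + t * G v) \<and>
     (\<exists>C. \<forall>v\<in>H10 \<Omega>. \<bar>G v\<bar> \<le> C * H1_norm \<Omega> v)}"


section \<open>Model problem\<close>

record ('n::finite) pde =
  pde_dom :: "(real^'n) set"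
  diffusion :: "real^'n \<Rightarrow> real^'n^'n"
  convection :: "'n vfn"
  reaction :: "'n fn"
  load :: "'n fn"
  vload :: "'n vfn"

definition form_a :: "'n::finite pde \<Rightarrow> 'n fn \<Rightarrow> 'n fn \<Rightarrow> real" where
  "form_a P u v = (LINT x|lebesgue_on (pde_dom P). (diffusion P x *v wgrad (pde_dom P) u x) \<bullet> wgrad (pde_dom P) v x)"

definition form_K :: "'n::finite pde \<Rightarrow> 'n fn \<Rightarrow> 'n fn \<Rightarrow> real" where
  "form_K P u v =
     (LINT x|lebesgue_on (pde_dom P). (convection P x \<bullet> wgrad (pde_dom P) u x + reaction P x * u x) * v x)"

definition form_b :: "'n::finite pde \<Rightarrow> 'n fn \<Rightarrow> 'n fn \<Rightarrow> real" where
  "form_b P u v = form_a P u v + form_K P u v"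

definition rhs_F :: "'n::finite pde \<Rightarrow> 'n fn \<Rightarrow> real" where
  "rhs_F P v = (LINT x|lebesgue_on (pde_dom P). load P x * v x) +
               (LINT x|lebesgue_on (pde_dom P). vload P x \<bullet> wgrad (pde_dom P) v x)"

definition enorm :: "'n::finite pde \<Rightarrow> 'n fn \<Rightarrow> real" where
  "enorm P v = sqrt (form_a P v v)"

definition model_problem :: "'n::finite pde \<Rightarrow> bool" where
  "model_problem P \<longleftrightarrow>
     polyhedral_lipschitz_domain (pde_dom P) \<and>
     (\<forall>i j. (\<lambda>x. diffusion P x $ i $ j) \<in> Linf_fun (pde_dom P)) \<and>
     (AE x in lebesgue_on (pde_dom P). transpose (diffusion P x) = diffusion P x) \<and>
     (\<forall>i. (\<lambda>x. convection P x $ i) \<in> Linf_fun (pde_dom P)) \<and>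
     reaction P \<in> Linf_fun (pde_dom P) \<and> load P \<in> L2_fun (pde_dom P) \<and> vload P \<in> L2_vec (pde_dom P) \<and>
     (\<exists>C. \<forall>u\<in>H10 (pde_dom P). \<forall>v\<in>H10 (pde_dom P).
        \<bar>form_b P u v\<bar> \<le> C * H1_norm (pde_dom P) u * H1_norm (pde_dom P) v) \<and>
     (\<exists>c>0. \<forall>u\<in>H10 (pde_dom P). c * (H1_norm (pde_dom P) u)\<^sup>2 \<le> form_b P u u)"

definition exact_solution :: "'n::finite pde \<Rightarrow> 'n fn \<Rightarrow> bool" where
  "exact_solution P u \<longleftrightarrow> u \<in> H10 (pde_dom P) \<and> (\<forall>v\<in>H10 (pde_dom P). form_b P u v = rhs_F P v)"


section \<open>Triangulations and newest vertex bisection\<close>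

text \<open>An element is a tagged simplex \<open>([z\<^sub>0, \<dots>, z\<^sub>d], \<gamma>)\<close> with type \<open>\<gamma> < d\<close> and refinement edge
  \<open>z\<^sub>0 z\<^sub>d\<close> (Maubach, Traxler, Stevenson 2008).  In dimension 2 the type plays no role and \<open>z\<^sub>1\<close> is
  the newest vertex.\<close>

type_synonym 'n tsimplex = "(real^'n) list \<times> nat"
type_synonym 'n mesh = "'n tsimplex set"

definition verts :: "'n::finite tsimplex \<Rightarrow> (real^'n) set" where
  "verts T = set (fst T)"

definition region :: "'n::finite tsimplex \<Rightarrow> (real^'n) set" where
  "region T = convex hull (verts T)"

definition tagged_simplex :: "'n::finite tsimplex \<Rightarrow> bool" where
  "tagged_simplex T \<longleftrightarrow> length (fst T) = CARD('n) + 1 \<and> distinct (fst T) \<and>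
     \<not> affine_dependent (verts T) \<and> snd T < CARD('n)"

definition conforming_mesh :: "(real^'n::finite) set \<Rightarrow> 'n mesh \<Rightarrow> bool" where
  "conforming_mesh \<Omega> \<T> \<longleftrightarrow> finite \<T> \<and> (\<forall>T\<in>\<T>. tagged_simplex T) \<and> inj_on region \<T> \<and>
     triangulation (region ` \<T>) \<and> \<Union>(region ` \<T>) = closure \<Omega>"

text \<open>Bisecting \<open>([z\<^sub>0, \<dots>, z\<^sub>d], \<gamma>)\<close> yields, with \<open>m = (z\<^sub>0 + z\<^sub>d) / 2\<close>, the elements
  \<open>[z\<^sub>0, m, z\<^sub>1, \<dots>, z\<^sub>\<gamma>, z\<^sub>\<gamma>\<^sub>+\<^sub>1, \<dots>, z\<^sub>d\<^sub>-\<^sub>1]\<close> and \<open>[z\<^sub>d, m, z\<^sub>1, \<dots>, z\<^sub>\<gamma>, z\<^sub>d\<^sub>-\<^sub>1, \<dots>, z\<^sub>\<gamma>\<^sub>+\<^sub>1]\<close>,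
  both of type \<open>(\<gamma> + 1) mod d\<close>.\<close>

definition children :: "'n::finite tsimplex \<Rightarrow> 'n tsimplex set" where
  "children T =
     (let z0 = hd (fst T); zd = last (fst T); m = (1/2) *\<^sub>R (z0 + zd);
          inner = butlast (tl (fst T)); p = take (snd T) inner; q = drop (snd T) inner;
          \<gamma> = (snd T + 1) mod CARD('n)
      in {(z0 # m # p @ q, \<gamma>), (zd # m # p @ rev q, \<gamma>)})"

text \<open>The reflected element has the same children as the original one.\<close>

definition reflect :: "'n::finite tsimplex \<Rightarrow> 'n tsimplex" where
  "reflect T =
     (let z0 = hd (fst T); zd = last (fst T); inner = butlast (tl (fst T))
      in (zd # take (snd T) inner @ rev (drop (snd T) inner) @ [z0], snd T))"

definition neighbours :: "'n::finite tsimplex \<Rightarrow> 'n tsimplex \<Rightarrow> bool" where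
  "neighbours T T' \<longleftrightarrow> card (verts T \<inter> verts T') = CARD('n)"

definition reflected_neighbours :: "'n::finite tsimplex \<Rightarrow> 'n tsimplex \<Rightarrow> bool" where
  "reflected_neighbours T T' \<longleftrightarrow> neighbours T T' \<and> snd T = snd T' \<and>
     (\<exists>S\<in>{T, reflect T}. card {i. i < CARD('n) + 1 \<and> fst S ! i \<noteq> fst T' ! i} = 1)"

definition ref_edge :: "'n::finite tsimplex \<Rightarrow> (real^'n) set" where
  "ref_edge T = {hd (fst T), last (fst T)}"

text \<open>Matching condition of Stevenson 2008.  If neither refinement edge lies in the common
  hyperface, then exactly one child of each of the two elements contains that hyperface.\<close>

definition stevenson_admissible :: "'n::finite mesh \<Rightarrow> bool" where
  "stevenson_admissible \<T> \<longleftrightarrow> (\<forall>T\<in>\<T>. \<forall>T'\<in>\<T>. snd T = snd T') \<and>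
     (\<forall>T\<in>\<T>. \<forall>T'\<in>\<T>. neighbours T T' \<longrightarrow>
        (if ref_edge T \<subseteq> verts T \<inter> verts T' \<or> ref_edge T' \<subseteq> verts T \<inter> verts T'
         then reflected_neighbours T T'
         else \<forall>K\<in>children T. \<forall>K'\<in>children T'.
                verts T \<inter> verts T' \<subseteq> verts K \<inter> verts K' \<longrightarrow> reflected_neighbours K K'))"

definition initial_mesh :: "(real^'n::finite) set \<Rightarrow> 'n mesh \<Rightarrow> bool" where
  "initial_mesh \<Omega> \<T> \<longleftrightarrow> conforming_mesh \<Omega> \<T> \<and> (3 \<le> CARD('n) \<longrightarrow> stevenson_admissible \<T>)"

inductive bisections :: "'n::finite mesh \<Rightarrow> 'n mesh \<Rightarrow> bool" for \<T> where
  refl: "bisections \<T> \<T>"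
| step: "bisections \<T> \<S> \<Longrightarrow> K \<in> \<S> \<Longrightarrow> bisections \<T> ((\<S> - {K}) \<union> children K)"

definition conforming_refinement ::
    "(real^'n::finite) set \<Rightarrow> 'n mesh \<Rightarrow> 'n mesh \<Rightarrow> 'n mesh \<Rightarrow> bool" where
  "conforming_refinement \<Omega> \<T> \<M> \<S> \<longleftrightarrow> bisections \<T> \<S> \<and> conforming_mesh \<Omega> \<S> \<and> \<M> \<inter> \<S> = {}"

text \<open>\<open>is_refine \<Omega> \<T> \<M> \<S>\<close> means \<open>\<S> = refine(\<T>, \<M>)\<close>: the coarsest conforming refinement.\<close>

definition is_refine :: "(real^'n::finite) set \<Rightarrow> 'n mesh \<Rightarrow> 'n mesh \<Rightarrow> 'n mesh \<Rightarrow> bool" where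
  "is_refine \<Omega> \<T> \<M> \<S> \<longleftrightarrow> conforming_refinement \<Omega> \<T> \<M> \<S> \<and>
     (\<forall>\<S>'. conforming_refinement \<Omega> \<T> \<M> \<S>' \<longrightarrow> bisections \<S> \<S>')"

inductive_set refinements :: "(real^'n::finite) set \<Rightarrow> 'n mesh \<Rightarrow> 'n mesh set" for \<Omega> \<T> where
  refl: "\<T> \<in> refinements \<Omega> \<T>"
| step: "\<S> \<in> refinements \<Omega> \<T> \<Longrightarrow> \<M> \<subseteq> \<S> \<Longrightarrow> is_refine \<Omega> \<S> \<M> \<S>' \<Longrightarrow> \<S>' \<in> refinements \<Omega> \<T>"


section \<open>Discrete spaces and discrete problems\<close>

definition polynomial_deg_le :: "nat \<Rightarrow> 'n::finite fn \<Rightarrow> bool" where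
  "polynomial_deg_le m p \<longleftrightarrow>
     (\<exists>c. \<forall>x. p x = (\<Sum>\<alpha> | (\<Sum>i\<in>UNIV. \<alpha> i) \<le> m. c \<alpha> * (\<Prod>i\<in>UNIV. (x $ i) ^ \<alpha> i)))"

definition fe_space :: "'n::finite pde \<Rightarrow> nat \<Rightarrow> 'n mesh \<Rightarrow> 'n fn set" where
  "fe_space P m \<T> = {v \<in> H10 (pde_dom P).
     \<forall>T\<in>\<T>. \<exists>p. polynomial_deg_le m p \<and> (AE x in lebesgue_on (region T). v x = p x)}"

definition galerkin_solution :: "'n::finite pde \<Rightarrow> nat \<Rightarrow> 'n mesh \<Rightarrow> 'n fn \<Rightarrow> bool" where
  "galerkin_solution P m \<T> w \<longleftrightarrow> w \<in> fe_space P m \<T> \<and> (\<forall>v\<in>fe_space P m \<T>. form_b P w v = rhs_F P v)"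

definition zarantonello_rhs :: "'n::finite pde \<Rightarrow> real \<Rightarrow> 'n fn \<Rightarrow> 'n fn \<Rightarrow> real" where
  "zarantonello_rhs P \<delta> u v = form_a P u v + \<delta> * (rhs_F P v - form_b P u v)"

definition zarantonello :: "'n::finite pde \<Rightarrow> nat \<Rightarrow> real \<Rightarrow> 'n mesh \<Rightarrow> 'n fn \<Rightarrow> 'n fn" where
  "zarantonello P m \<delta> \<T> u =
     (SOME w. w \<in> fe_space P m \<T> \<and> (\<forall>v\<in>fe_space P m \<T>. form_a P w v = zarantonello_rhs P \<delta> u v))"

definition zarantonello_contraction :: "'n::finite pde \<Rightarrow> nat \<Rightarrow> 'n mesh \<Rightarrow> real \<Rightarrow> real \<Rightarrow> bool" where
  "zarantonello_contraction P m \<T>0 \<delta> qsym \<longleftrightarrow> 0 < qsym \<and> qsym < 1 \<and>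
     (\<forall>\<T>\<in>refinements (pde_dom P) \<T>0. \<forall>u\<in>fe_space P m \<T>. \<forall>w\<in>fe_space P m \<T>.
        enorm P (zarantonello P m \<delta> \<T> u - zarantonello P m \<delta> \<T> w) \<le> qsym * enorm P (u - w))"

type_synonym 'n solver = "'n mesh \<Rightarrow> ('n fn \<Rightarrow> real) \<Rightarrow> 'n fn \<Rightarrow> 'n fn"

definition algebraic_solver :: "'n::finite pde \<Rightarrow> nat \<Rightarrow> 'n mesh \<Rightarrow> 'n solver \<Rightarrow> real \<Rightarrow> bool" where
  "algebraic_solver P m \<T>0 \<Psi> qalg \<longleftrightarrow> 0 < qalg \<and> qalg < 1 \<and>
     (\<forall>\<T>\<in>refinements (pde_dom P) \<T>0. \<forall>G\<in>dual_H10 (pde_dom P). \<forall>w\<in>fe_space P m \<T>.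
        \<Psi> \<T> G w \<in> fe_space P m \<T> \<and>
        (\<forall>ws\<in>fe_space P m \<T>. (\<forall>v\<in>fe_space P m \<T>. form_a P ws v = G v) \<longrightarrow>
           enorm P (ws - \<Psi> \<T> G w) \<le> qalg * enorm P (ws - w)))"


section \<open>Error estimator\<close>

type_synonym 'n estimator = "'n mesh \<Rightarrow> 'n tsimplex \<Rightarrow> 'n fn \<Rightarrow> real"

definition est :: "'n estimator \<Rightarrow> 'n mesh \<Rightarrow> 'n mesh \<Rightarrow> 'n fn \<Rightarrow> real" where
  "est \<eta> \<T> \<U> v = sqrt (\<Sum>T\<in>\<U>. (\<eta> \<T> T v)\<^sup>2)"

definition estimator_nonneg :: "'n::finite pde \<Rightarrow> nat \<Rightarrow> 'n mesh \<Rightarrow> 'n estimator \<Rightarrow> bool" where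
  "estimator_nonneg P m \<T>0 \<eta> \<longleftrightarrow>
     (\<forall>\<T>\<in>refinements (pde_dom P) \<T>0. \<forall>T\<in>\<T>. \<forall>v\<in>fe_space P m \<T>. 0 \<le> \<eta> \<T> T v)"

definition A1_stability :: "'n::finite pde \<Rightarrow> nat \<Rightarrow> 'n mesh \<Rightarrow> 'n estimator \<Rightarrow> real \<Rightarrow> bool" where
  "A1_stability P m \<T>0 \<eta> Cstab \<longleftrightarrow>
     (\<forall>\<T>\<in>refinements (pde_dom P) \<T>0. \<forall>\<S>\<in>refinements (pde_dom P) \<T>.
        \<forall>v\<in>fe_space P m \<S>. \<forall>w\<in>fe_space P m \<T>. \<forall>\<U>. \<U> \<subseteq> \<T> \<inter> \<S> \<longrightarrow>
          \<bar>est \<eta> \<S> \<U> v - est \<eta> \<T> \<U> w\<bar> \<le> Cstab * enorm P (v - w))"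

definition A2_reduction :: "'n::finite pde \<Rightarrow> nat \<Rightarrow> 'n mesh \<Rightarrow> 'n estimator \<Rightarrow> real \<Rightarrow> bool" where
  "A2_reduction P m \<T>0 \<eta> qred \<longleftrightarrow>
     (\<forall>\<T>\<in>refinements (pde_dom P) \<T>0. \<forall>\<S>\<in>refinements (pde_dom P) \<T>. \<forall>v\<in>fe_space P m \<T>.
        est \<eta> \<S> (\<S> - \<T>) v \<le> qred * est \<eta> \<T> (\<T> - \<S>) v)"

definition A3_reliability ::
    "'n::finite pde \<Rightarrow> nat \<Rightarrow> 'n mesh \<Rightarrow> 'n estimator \<Rightarrow> 'n fn \<Rightarrow> real \<Rightarrow> bool" where
  "A3_reliability P m \<T>0 \<eta> uex Crel \<longleftrightarrow>
     (\<forall>\<T>\<in>refinements (pde_dom P) \<T>0. \<forall>w. galerkin_solution P m \<T> w \<longrightarrow>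
        enorm P (uex - w) \<le> Crel * est \<eta> \<T> \<T> w)"


section \<open>The AISFEM algorithm\<close>

text \<open>The quantities produced by the algorithm: \<open>\<T>\<^sub>\<ell>\<close>, \<open>\<M>\<^sub>\<ell>\<close>, \<open>u\<^sub>\<ell>\<^sup>k\<^sup>,\<^sup>j\<close>, \<open>u\<^sub>\<ell>\<^sup>k\<^sup>,\<^sup>\<star>\<close> and the final
  counters of the \<open>k\<close>-loops and \<open>j\<close>-loops.  Only values at indices that are reached matter.\<close>

record ('n::finite) aisfem_output =
  msh :: "nat \<Rightarrow> 'n mesh"
  marked :: "nat \<Rightarrow> 'n mesh"
  iter :: "nat \<Rightarrow> nat \<Rightarrow> nat \<Rightarrow> 'n fn"
  star :: "nat \<Rightarrow> nat \<Rightarrow> 'n fn"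
  last_k :: "nat \<Rightarrow> nat"
  last_j :: "nat \<Rightarrow> nat \<Rightarrow> nat"

definition iter_last :: "'n::finite aisfem_output \<Rightarrow> nat \<Rightarrow> nat \<Rightarrow> 'n fn" where
  "iter_last R l k = iter R l k (last_j R l k)"

definition stop_alg ::
    "'n::finite pde \<Rightarrow> 'n estimator \<Rightarrow> real \<Rightarrow> real \<Rightarrow> 'n aisfem_output \<Rightarrow> nat \<Rightarrow> nat \<Rightarrow> nat \<Rightarrow> bool" where
  "stop_alg P \<eta> lsym lalg R l k j \<longleftrightarrow>
     enorm P (iter R l k j - iter R l k (j - 1)) \<le>
       lalg * (lsym * est \<eta> (msh R l) (msh R l) (iter R l k j) +
               enorm P (iter R l k j - iter_last R l (k - 1)))"

definition stop_sym ::
    "'n::finite pde \<Rightarrow> 'n estimator \<Rightarrow> real \<Rightarrow> 'n aisfem_output \<Rightarrow> nat \<Rightarrow> nat \<Rightarrow> bool" where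
  "stop_sym P \<eta> lsym R l k \<longleftrightarrow>
     enorm P (iter_last R l k - iter_last R l (k - 1)) \<le>
       lsym * est \<eta> (msh R l) (msh R l) (iter_last R l k)"

text \<open>The index set \<open>\<Q>\<close>, generated by the control flow of the algorithm.\<close>

inductive_set index_set ::
    "'n::finite pde \<Rightarrow> 'n estimator \<Rightarrow> real \<Rightarrow> real \<Rightarrow> 'n aisfem_output \<Rightarrow> (nat \<times> nat \<times> nat) set"
  for P \<eta> lsym lalg R where
  start: "(0, 0, 0) \<in> index_set P \<eta> lsym lalg R"
| enter_k: "(l, 0, 0) \<in> index_set P \<eta> lsym lalg R \<Longrightarrow> (l, 1, 0) \<in> index_set P \<eta> lsym lalg R"
| enter_j: "(l, k, 0) \<in> index_set P \<eta> lsym lalg R \<Longrightarrow> 1 \<le> k \<Longrightarrow> (l, k, 1) \<in> index_set P \<eta> lsym lalg R"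
| next_j: "(l, k, j) \<in> index_set P \<eta> lsym lalg R \<Longrightarrow> 1 \<le> k \<Longrightarrow> 1 \<le> j \<Longrightarrow>
     \<not> stop_alg P \<eta> lsym lalg R l k j \<Longrightarrow> (l, k, j + 1) \<in> index_set P \<eta> lsym lalg R"
| next_k: "(l, k, j) \<in> index_set P \<eta> lsym lalg R \<Longrightarrow> 1 \<le> k \<Longrightarrow> 1 \<le> j \<Longrightarrow>
     stop_alg P \<eta> lsym lalg R l k j \<Longrightarrow> \<not> stop_sym P \<eta> lsym R l k \<Longrightarrow>
     (l, k + 1, 0) \<in> index_set P \<eta> lsym lalg R"
| next_l: "(l, k, j) \<in> index_set P \<eta> lsym lalg R \<Longrightarrow> 1 \<le> k \<Longrightarrow> 1 \<le> j \<Longrightarrow>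
     stop_alg P \<eta> lsym lalg R l k j \<Longrightarrow> stop_sym P \<eta> lsym R l k \<Longrightarrow>
     (l + 1, 0, 0) \<in> index_set P \<eta> lsym lalg R"

definition doerfler :: "'n estimator \<Rightarrow> real \<Rightarrow> 'n mesh \<Rightarrow> 'n fn \<Rightarrow> 'n mesh \<Rightarrow> bool" where
  "doerfler \<eta> \<theta> \<T> v \<M> \<longleftrightarrow> \<M> \<subseteq> \<T> \<and> \<theta> * (est \<eta> \<T> \<T> v)\<^sup>2 \<le> (est \<eta> \<T> \<M> v)\<^sup>2"

definition quasi_minimal_doerfler ::
    "'n estimator \<Rightarrow> real \<Rightarrow> real \<Rightarrow> 'n mesh \<Rightarrow> 'n fn \<Rightarrow> 'n mesh \<Rightarrow> bool" where
  "quasi_minimal_doerfler \<eta> \<theta> Cmark \<T> v \<M> \<longleftrightarrow> doerfler \<eta> \<theta> \<T> v \<M> \<and>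
     (\<forall>\<M>'. doerfler \<eta> \<theta> \<T> v \<M>' \<longrightarrow> real (card \<M>) \<le> Cmark * real (card \<M>'))"

text \<open>\<open>R\<close> is an output of the algorithm.  The algorithm leaves the choice of the marked elements
  open, hence a predicate.  The first two conditions are the types \<open>u\<^sub>\<ell>\<^sup>k\<^sup>,\<^sup>j, u\<^sub>\<ell>\<^sup>k\<^sup>,\<^sup>\<star> \<in> \<X>\<^sub>\<ell>\<close> of the
  computed quantities.\<close>

definition aisfem ::
    "'n::finite pde \<Rightarrow> nat \<Rightarrow> 'n mesh \<Rightarrow> 'n estimator \<Rightarrow> 'n solver \<Rightarrow>
     real \<Rightarrow> real \<Rightarrow> real \<Rightarrow> real \<Rightarrow> real \<Rightarrow> 'n aisfem_output \<Rightarrow> bool" where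
  "aisfem P m \<T>0 \<eta> \<Psi> \<delta> \<theta> Cmark lsym lalg R \<longleftrightarrow>
     (let Q = index_set P \<eta> lsym lalg R in
      (\<forall>(l, k, j)\<in>Q. iter R l k j \<in> fe_space P m (msh R l)) \<and>
      (\<forall>(l, k, j)\<in>Q. star R l k \<in> fe_space P m (msh R l)) \<and>
      msh R 0 = \<T>0 \<and> iter R 0 0 0 = (\<lambda>_. 0) \<and> star R 0 0 = (\<lambda>_. 0) \<and> last_j R 0 0 = 0 \<and>
      (\<forall>l k. (l, k, 0) \<in> Q \<and> 1 \<le> k \<longrightarrow>
         iter R l k 0 = iter_last R l (k - 1) \<and>
         star R l k = zarantonello P m \<delta> (msh R l) (iter_last R l (k - 1))) \<and>
      (\<forall>l k j. (l, k, j) \<in> Q \<and> 1 \<le> k \<and> 1 \<le> j \<longrightarrow>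
         iter R l k j =
           \<Psi> (msh R l) (zarantonello_rhs P \<delta> (iter_last R l (k - 1))) (iter R l k (j - 1))) \<and>
      (\<forall>l k j. (l, k, j) \<in> Q \<and> 1 \<le> k \<and> 1 \<le> j \<and> stop_alg P \<eta> lsym lalg R l k j \<longrightarrow>
         last_j R l k = j \<and>
         (stop_sym P \<eta> lsym R l k \<longrightarrow>
            last_k R l = k \<and>
            quasi_minimal_doerfler \<eta> \<theta> Cmark (msh R l) (iter_last R l (last_k R l)) (marked R l) \<and>
            is_refine (pde_dom P) (msh R l) (marked R l) (msh R (l + 1)) \<and>
            iter R (l + 1) 0 0 = iter_last R l (last_k R l) \<and>
            star R (l + 1) 0 = iter_last R l (last_k R l) \<and>
            last_j R (l + 1) 0 = 0)))"

definition l_sup :: "(nat \<times> nat \<times> nat) set \<Rightarrow> enat" where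
  "l_sup Q = (SUP l\<in>{l. (l, 0, 0) \<in> Q}. enat l)"

fun idx_le :: "nat \<times> nat \<times> nat \<Rightarrow> nat \<times> nat \<times> nat \<Rightarrow> bool" where
  "idx_le (l', k', j') (l, k, j) \<longleftrightarrow> l' < l \<or> l' = l \<and> (k' < k \<or> k' = k \<and> j' \<le> j)"

definition idx_rank :: "(nat \<times> nat \<times> nat) set \<Rightarrow> nat \<times> nat \<times> nat \<Rightarrow> nat" where
  "idx_rank Q q = card {q'\<in>Q. idx_le q' q}"

definition quasi_error ::
    "'n::finite pde \<Rightarrow> 'n estimator \<Rightarrow> 'n fn \<Rightarrow> 'n aisfem_output \<Rightarrow> nat \<times> nat \<times> nat \<Rightarrow> real" where
  "quasi_error P \<eta> uex R = (\<lambda>(l, k, j).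
     enorm P (uex - iter R l k j) + enorm P (star R l k - iter R l k j) +
     est \<eta> (msh R l) (msh R l) (iter R l k j))"

definition full_linear_convergence ::
    "(nat \<times> nat \<times> nat) set \<Rightarrow> (nat \<times> nat \<times> nat \<Rightarrow> real) \<Rightarrow> real \<Rightarrow> real \<Rightarrow> nat \<Rightarrow> bool" where
  "full_linear_convergence Q \<Delta> Clin qlin l0 \<longleftrightarrow>
     0 < Clin \<and> 0 < qlin \<and> qlin < 1 \<and> enat l0 \<le> l_sup Q \<and>
     (\<forall>q\<in>Q. \<forall>q'\<in>Q. idx_rank Q q' < idx_rank Q q \<and> l0 \<le> fst q' \<longrightarrow>
        \<Delta> q \<le> Clin * qlin ^ (idx_rank Q q - idx_rank Q q') * \<Delta> q')"

definition linear_convergence_threshold ::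
    "'n::finite pde \<Rightarrow> nat \<Rightarrow> 'n mesh \<Rightarrow> 'n estimator \<Rightarrow> 'n solver \<Rightarrow> 'n fn \<Rightarrow>
     real \<Rightarrow> real \<Rightarrow> real \<Rightarrow> real \<Rightarrow> real \<Rightarrow> bool" where
  "linear_convergence_threshold P m \<T>0 \<eta> \<Psi> uex \<delta> \<theta> Cmark lsym lalg' \<longleftrightarrow>
     (\<forall>lalg R. 0 < lalg \<and> lalg \<le> lalg' \<and> aisfem P m \<T>0 \<eta> \<Psi> \<delta> \<theta> Cmark lsym lalg R \<longrightarrow>
        (\<exists>Clin qlin l0. full_linear_convergence
           (index_set P \<eta> lsym lalg R) (quasi_error P \<eta> uex R) Clin qlin l0))"

definition num_elements :: "'n::finite aisfem_output \<Rightarrow> nat \<times> nat \<times> nat \<Rightarrow> real" where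
  "num_elements R q = real (card (msh R (fst q)))"

end

theory Submission
  imports Defs
begin

text \<open>Full linear convergence makes the numbers of elements accumulated along the algorithm
  comparable with the current one. If \<open>M\<close> bounds \<open>(#\<T>)\<^sup>s \<Delta>\<close>, then every earlier mesh satisfies
  \<open>#\<T>' \<le> (M / \<Delta>')\<^bsup>1/s\<^esup>\<close>, and \<open>\<Delta> \<le> C q\<^sup>n \<Delta>'\<close>, where \<open>n\<close> is the number of steps in between, turns this
  into \<open>#\<T>' \<le> (C M / \<Delta>)\<^bsup>1/s\<^esup> (q\<^bsup>1/s\<^esup>)\<^sup>n\<close>. Different steps have different \<open>n\<close>, so the sum over all earlier
  steps is dominated by a geometric series (\<open>weighted_cost_le_weighted_size\<close>). Passing from the
  indices with \<open>\<ell> \<ge> \<ell>\<^sub>0\<close> to all of \<open>\<Q>\<close> adds only finitely many terms, which does not affect finiteness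
  (\<open>weighted_cost_finite_extend\<close>).

  Two points need the algorithm itself. First, ranks count steps only if each index has finitely
  many predecessors: \<open>\<Q>\<close> is the orbit of \<open>(0,0,0)\<close> under a lexicographically increasing successor map,
  hence order isomorphic to the natural numbers (\<open>finite_predecessors\<close>).

  Second, the geometric series includes the current step \<open>n = 0\<close>, where the linear convergence
  estimate says nothing and \<open>C \<ge> 1\<close> is required. This follows from the nested iteration: entering
  the \<open>k\<close>-loop on level \<open>\<ell>\<^sub>0\<close> keeps the iterate and replaces the auxiliary function
  \<open>u\<^sup>0\<^sup>,\<^sup>\<star> = u\<^sup>0\<^sup>,\<^sup>0\<close> by \<open>u\<^sup>1\<^sup>,\<^sup>\<star>\<close>, so the quasi-error does not decrease in this step
  (\<open>quasi_error_first_step\<close>). Hence \<open>C \<ge> 1\<close> unless the quasi-error is not positive there, and in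
  that case all later contributions vanish (\<open>linear_convergence_dichotomy\<close>).\<close>

section \<open>Cumulative cost under linear convergence\<close>

text \<open>In this part \<open>r\<close> is the position in the order of computation, \<open>N\<close> the size of a step and \<open>D\<close>
  its error. Steps with \<open>D \<le> 0\<close> contribute nothing to the suprema, since \<^const>\<open>ennreal\<close> sends
  negative numbers to \<open>0\<close>.\<close>

lemma finite_rank_le:
  fixes r :: "'a \<Rightarrow> nat"
  assumes "inj_on r S"
  shows "finite {y \<in> S. r y \<le> n}"
proof (rule finite_imageD)
  show "finite (r ` {y \<in> S. r y \<le> n})"
    by (rule finite_subset[of _ "{..n}"]) auto
  show "inj_on r {y \<in> S. r y \<le> n}"
    using assms by (rule inj_on_subset) auto
qed

lemma weighted_size_le_weighted_cost:
  fixes r :: "'a \<Rightarrow> nat" and N D :: "'a \<Rightarrow> real"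
  assumes inj: "inj_on r S" and N: "\<And>y. y \<in> S \<Longrightarrow> 0 \<le> N y" and s: "0 < s"
  shows "(SUP x\<in>S. ennreal (N x powr s * D x)) \<le>
    (SUP x\<in>S. ennreal ((\<Sum>y | y \<in> S \<and> r y \<le> r x. N y) powr s * D x))"
proof (rule SUP_mono)
  fix x assume x: "x \<in> S"
  let ?c = "\<Sum>y | y \<in> S \<and> r y \<le> r x. N y"
  have "N x \<le> ?c"
    using finite_rank_le[OF inj, of "r x"] x N by (intro member_le_sum) auto
  then have "N x powr s \<le> ?c powr s"
    using N[OF x] s by (intro powr_mono2) auto
  then have "ennreal (N x powr s * D x) \<le> ennreal (?c powr s * D x)"
  proof (cases "0 \<le> D x")
    case False
    then have "N x powr s * D x \<le> 0"
      by (intro mult_nonneg_nonpos) auto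
    then show ?thesis by (simp add: ennreal_neg)
  qed (auto intro!: ennreal_leI mult_right_mono)
  then show "\<exists>x'\<in>S. ennreal (N x powr s * D x) \<le>
      ennreal ((\<Sum>y | y \<in> S \<and> r y \<le> r x'. N y) powr s * D x')"
    using x by blast
qed

lemma sum_geometric_rank_le:
  fixes r :: "'a \<Rightarrow> nat" and p :: real
  assumes inj: "inj_on r S" and p: "0 \<le> p" "p < 1"
  shows "(\<Sum>y | y \<in> S \<and> r y \<le> n. p ^ (n - r y)) \<le> 1 / (1 - p)"
proof -
  let ?A = "{y \<in> S. r y \<le> n}"
  have "inj_on (\<lambda>y. n - r y) ?A"
    using inj by (auto simp: inj_on_def)
  then have "(\<Sum>y\<in>?A. p ^ (n - r y)) = (\<Sum>i\<in>(\<lambda>y. n - r y) ` ?A. p ^ i)"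
    by (simp add: sum.reindex)
  also have "\<dots> \<le> (\<Sum>i. p ^ i)"
    using p finite_rank_le[OF inj] by (intro sum_le_suminf) auto
  also have "\<dots> = 1 / (1 - p)"
    using p by (intro suminf_geometric) auto
  finally show ?thesis by simp
qed

text \<open>The bound on the size of one step at distance \<open>n\<close> before a step of error \<open>d\<close>: solve
  \<open>N\<^sup>s d' \<le> \<mu>\<close> for \<open>N\<close> and use \<open>d \<le> C q\<^sup>n d'\<close>.\<close>

lemma size_le_of_later_error:
  fixes N d d' \<mu> C q s :: real
  assumes s: "0 < s" and q: "0 < q" and C: "0 < C" and N: "0 \<le> N"
    and d: "0 < d" and le: "d \<le> C * q ^ n * d'" and \<mu>: "N powr s * d' \<le> \<mu>"
  shows "N \<le> (C * \<mu> / d) powr (1 / s) * (q powr (1 / s)) ^ n"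
proof -
  have "0 < C * q ^ n * d'" using d le by linarith
  moreover have Cq: "0 < C * q ^ n" using C q by simp
  ultimately have d': "0 < d'" by (simp add: zero_less_mult_iff)
  have "N powr s * d \<le> N powr s * (C * q ^ n * d')"
    using le by (intro mult_left_mono) auto
  also have "\<dots> = C * q ^ n * (N powr s * d')" by simp
  also have "\<dots> \<le> C * q ^ n * \<mu>"
    using \<mu> Cq by (intro mult_left_mono) auto
  finally have Ns: "N powr s \<le> C * \<mu> / d * q ^ n"
    using d by (simp add: field_simps)
  have "0 \<le> N powr s * d'" using d' by simp
  then have \<mu>0: "0 \<le> \<mu>" using \<mu> by linarith
  have "N = (N powr s) powr (1 / s)"
    using s N by (simp add: powr_powr)
  also have "\<dots> \<le> (C * \<mu> / d * q ^ n) powr (1 / s)"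
    using Ns s by (intro powr_mono2) auto
  also have "\<dots> = (C * \<mu> / d) powr (1 / s) * (q ^ n) powr (1 / s)"
    by (rule powr_mult)
  also have "(q ^ n) powr (1 / s) = (q powr (1 / s)) ^ n"
    using q by (simp add: powr_realpow[symmetric] powr_powr mult.commute)
  finally show ?thesis .
qed

text \<open>The assumption \<open>1 \<le> C\<close> serves the summand of the current step, to which the convergence
  estimate between different steps does not apply.\<close>

lemma weighted_cost_le_weighted_size:
  fixes r :: "'a \<Rightarrow> nat" and N D :: "'a \<Rightarrow> real"
  assumes inj: "inj_on r S" and N: "\<And>y. y \<in> S \<Longrightarrow> 0 \<le> N y" and s: "0 < s"
    and q: "0 < q" "q < 1" and C: "1 \<le> C"
    and lin: "\<And>x y. x \<in> S \<Longrightarrow> y \<in> S \<Longrightarrow> r y < r x \<Longrightarrow> D x \<le> C * q ^ (r x - r y) * D y"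
  shows "(SUP x\<in>S. ennreal ((\<Sum>y | y \<in> S \<and> r y \<le> r x. N y) powr s * D x)) \<le>
    ennreal (C / (1 - q powr (1 / s)) powr s) * (SUP x\<in>S. ennreal (N x powr s * D x))"
    (is "_ \<le> ennreal ?K * ?M")
proof -
  define p where "p = q powr (1 / s)"
  have p: "0 < p" "p < 1"
    using q s powr_less_mono2[of "1 / s" q 1] by (auto simp: p_def)
  define \<kappa> where "\<kappa> = ?K"
  have K: "0 < \<kappa>"
    using C p unfolding \<kappa>_def p_def[symmetric] by simp
  have "(SUP x\<in>S. ennreal ((\<Sum>y | y \<in> S \<and> r y \<le> r x. N y) powr s * D x)) \<le> ennreal \<kappa> * ?M"
  proof (cases "?M = \<infinity>")
    case True
    show ?thesis unfolding True using K by (simp add: ennreal_mult_top)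
  next
    case False
    then obtain \<mu> where \<mu>: "0 \<le> \<mu>" "?M = ennreal \<mu>"
      by (cases ?M) auto
    have "ennreal ((\<Sum>y | y \<in> S \<and> r y \<le> r x. N y) powr s * D x) \<le> ennreal (\<kappa> * \<mu>)"
      if x: "x \<in> S" for x
    proof (cases "0 < D x")
      case False
      then have "(\<Sum>y | y \<in> S \<and> r y \<le> r x. N y) powr s * D x \<le> 0"
        by (intro mult_nonneg_nonpos) auto
      then show ?thesis by (simp add: ennreal_neg)
    next
      case D: True
      let ?A = "{y \<in> S. r y \<le> r x}" and ?B = "(C * \<mu> / D x) powr (1 / s)"
      have step: "N y \<le> ?B * p ^ (r x - r y)" if y: "y \<in> ?A" for y
      proof -
        have "D x \<le> C * q ^ (r x - r y) * D y"
        proof (cases "r y < r x")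
          case False
          then have "y = x" using x y inj by (auto simp: inj_on_def)
          then show ?thesis using C D by simp
        qed (use lin x y in auto)
        moreover have "ennreal (N y powr s * D y) \<le> ennreal \<mu>"
          unfolding \<mu>(2)[symmetric] using y by (intro SUP_upper) auto
        then have "N y powr s * D y \<le> \<mu>"
          using \<mu>(1) by (simp add: ennreal_le_iff)
        ultimately show ?thesis
          unfolding p_def using s q C N[of y] y D by (intro size_le_of_later_error[of _ _ _ _ "D x" _ "D y"]) auto
      qed
      have "(\<Sum>y\<in>?A. N y) \<le> (\<Sum>y\<in>?A. ?B * p ^ (r x - r y))"
        using step by (rule sum_mono)
      also have "\<dots> = ?B * (\<Sum>y\<in>?A. p ^ (r x - r y))"
        by (simp add: sum_distrib_left)
      also have "\<dots> \<le> ?B * (1 / (1 - p))"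
        using sum_geometric_rank_le[OF inj] p by (intro mult_left_mono) auto
      finally have "(\<Sum>y\<in>?A. N y) powr s \<le> (?B / (1 - p)) powr s"
        using N s by (intro powr_mono2 sum_nonneg) auto
      also have "\<dots> = ?B powr s / (1 - p) powr s"
        by (rule powr_divide)
      also have "?B powr s = C * \<mu> / D x"
        using s C D \<mu> by (simp add: powr_powr)
      finally have "(\<Sum>y\<in>?A. N y) powr s * D x \<le> C * \<mu> / D x / (1 - p) powr s * D x"
        using D by (intro mult_right_mono) auto
      also have "\<dots> = \<kappa> * \<mu>"
        using D by (simp add: \<kappa>_def p_def)
      finally show ?thesis by (intro ennreal_leI) auto
    qed
    then have "(SUP x\<in>S. ennreal ((\<Sum>y | y \<in> S \<and> r y \<le> r x. N y) powr s * D x)) \<le> ennreal (\<kappa> * \<mu>)"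
      by (intro SUP_least)
    also have "\<dots> = ennreal \<kappa> * ?M"
      using K \<mu> by (simp add: ennreal_mult)
    finally show ?thesis .
  qed
  then show ?thesis by (simp only: \<kappa>_def)
qed

text \<open>As sizes are at least \<open>1\<close>, the total size \<open>c\<close> of finitely many additional steps enlarges every
  cumulative sum at most by the factor \<open>1 + c\<close>.\<close>

lemma weighted_cost_finite_extend:
  fixes r :: "'a \<Rightarrow> nat" and N D :: "'a \<Rightarrow> real"
  assumes inj: "inj_on r Q" and N: "\<And>y. y \<in> Q \<Longrightarrow> 1 \<le> N y" and s: "0 < s"
    and S: "S \<subseteq> Q" "finite (Q - S)"
    and fin: "(SUP x\<in>S. ennreal ((\<Sum>y | y \<in> S \<and> r y \<le> r x. N y) powr s * D x)) < \<infinity>"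
  shows "(SUP x\<in>Q. ennreal ((\<Sum>y | y \<in> Q \<and> r y \<le> r x. N y) powr s * D x)) < \<infinity>"
proof -
  let ?W = "SUP x\<in>S. ennreal ((\<Sum>y | y \<in> S \<and> r y \<le> r x. N y) powr s * D x)"
  let ?t = "\<lambda>x. ennreal ((\<Sum>y | y \<in> Q \<and> r y \<le> r x. N y) powr s * D x)"
  define c where "c = (\<Sum>y\<in>Q - S. N y)"
  have N0: "0 \<le> N y" if "y \<in> Q" for y using N[OF that] by linarith
  have c: "0 \<le> c" unfolding c_def using N0 by (intro sum_nonneg) auto
  let ?B = "ennreal ((1 + c) powr s) * ?W + (\<Sum>x\<in>Q - S. ?t x)"
  have "?t x \<le> ?B" if x: "x \<in> Q" for x
  proof (cases "x \<in> S")
    case False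
    then have "?t x \<le> (\<Sum>x\<in>Q - S. ?t x)"
      using S x by (intro member_le_sum) auto
    then show ?thesis by (rule order_trans) simp
  next
    case xS: True
    let ?A = "{y \<in> Q. r y \<le> r x}" and ?A' = "{y \<in> S. r y \<le> r x}"
    have finA: "finite ?A" "finite ?A'"
      using finite_rank_le[OF inj] S(1) by (auto intro: finite_subset[of ?A' ?A])
    have "N x \<le> (\<Sum>y\<in>?A'. N y)"
      using finA xS S N0 by (intro member_le_sum) auto
    then have ge1: "1 \<le> (\<Sum>y\<in>?A'. N y)" using N[OF x] by linarith
    have "(\<Sum>y\<in>?A. N y) \<le> (\<Sum>y\<in>?A' \<union> (Q - S). N y)"
      using finA S N0 by (intro sum_mono2) auto
    also have "\<dots> = (\<Sum>y\<in>?A'. N y) + c"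
      unfolding c_def using finA S by (intro sum.union_disjoint) auto
    also have "\<dots> \<le> (1 + c) * (\<Sum>y\<in>?A'. N y)"
      using mult_left_mono[OF ge1 c] by (simp add: algebra_simps)
    finally have "(\<Sum>y\<in>?A. N y) powr s \<le> ((1 + c) * (\<Sum>y\<in>?A'. N y)) powr s"
      using s N0 by (intro powr_mono2 sum_nonneg) auto
    also have "\<dots> = (1 + c) powr s * (\<Sum>y\<in>?A'. N y) powr s"
      by (rule powr_mult)
    finally have le: "(\<Sum>y\<in>?A. N y) powr s \<le> (1 + c) powr s * (\<Sum>y\<in>?A'. N y) powr s" .
    have "?t x \<le> ennreal ((1 + c) powr s) * ennreal ((\<Sum>y\<in>?A'. N y) powr s * D x)"
    proof (cases "0 \<le> D x")
      case True
      then have "?t x \<le> ennreal ((1 + c) powr s * (\<Sum>y\<in>?A'. N y) powr s * D x)"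
        using le by (intro ennreal_leI mult_right_mono)
      then show ?thesis using True by (simp add: ennreal_mult[symmetric] mult.assoc)
    next
      case False
      then have "(\<Sum>y\<in>?A. N y) powr s * D x \<le> 0"
        by (intro mult_nonneg_nonpos) auto
      then show ?thesis by (simp add: ennreal_neg)
    qed
    also have "\<dots> \<le> ennreal ((1 + c) powr s) * ?W"
      using xS by (intro mult_left_mono SUP_upper) auto
    finally show ?thesis by (rule order_trans) simp
  qed
  then have "(SUP x\<in>Q. ?t x) \<le> ?B" by (intro SUP_least)
  moreover have "(\<Sum>x\<in>Q - S. ?t x) < \<infinity>"
    using S(2) by (induction rule: finite_induct) auto
  then have "?B < \<infinity>"
    using fin by (simp add: ennreal_mult_less_top)
  ultimately show ?thesis by (rule le_less_trans)
qed

section \<open>The index set as an increasing orbit\<close>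

text \<open>The step of the algorithm as a total function. It increases the index on all triples, also on
  those that the algorithm never reaches.\<close>

fun next_index ::
    "'n::finite pde \<Rightarrow> 'n estimator \<Rightarrow> real \<Rightarrow> real \<Rightarrow> 'n aisfem_output \<Rightarrow>
     nat \<times> nat \<times> nat \<Rightarrow> nat \<times> nat \<times> nat" where
  "next_index P \<eta> lsym lalg R (l, k, j) =
     (if k = 0 then (l, 1, 0) else if j = 0 then (l, k, 1)
      else if \<not> stop_alg P \<eta> lsym lalg R l k j then (l, k, j + 1)
      else if \<not> stop_sym P \<eta> lsym R l k then (l, k + 1, 0) else (l + 1, 0, 0))"

lemma idx_le_refl: "idx_le a a"
  by (cases a) auto

lemma idx_le_trans: "idx_le a b \<Longrightarrow> idx_le b c \<Longrightarrow> idx_le a c"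
  by (cases a; cases b; cases c) auto

lemma idx_le_antisym: "idx_le a b \<Longrightarrow> idx_le b a \<Longrightarrow> a = b"
  by (cases a; cases b) auto

lemma idx_le_total: "idx_le a b \<or> idx_le b a"
  by (cases a; cases b) auto

lemma idx_le_next_index: "idx_le a (next_index P \<eta> lsym lalg R a)"
  by (cases a) auto

lemma not_next_index_le: "\<not> idx_le (next_index P \<eta> lsym lalg R a) a"
  by (cases a) auto

lemma orbit_mono:
  assumes "m \<le> n"
  shows "idx_le ((next_index P \<eta> lsym lalg R ^^ m) a) ((next_index P \<eta> lsym lalg R ^^ n) a)"
  using assms
proof (induction n rule: dec_induct)
  case (step n)
  then show ?case using idx_le_next_index idx_le_trans by (simp, blast)
qed (simp add: idx_le_refl)

lemma index_set_in_orbit: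
  assumes "(l, k, j) \<in> index_set P \<eta> lsym lalg R"
  shows "\<exists>n. (l, k, j) = (next_index P \<eta> lsym lalg R ^^ n) (0, 0, 0)"
  using assms
proof (induction rule: index_set.induct)
  case start
  then show ?case by (metis funpow_0)
next
  case (enter_k l)
  then obtain n where "(l, 0, 0) = (next_index P \<eta> lsym lalg R ^^ n) (0, 0, 0)" by blast
  from this[symmetric] show ?case by (intro exI[of _ "Suc n"]) simp
next
  case (enter_j l k)
  then obtain n where "(l, k, 0) = (next_index P \<eta> lsym lalg R ^^ n) (0, 0, 0)" by blast
  from this[symmetric] show ?case using enter_j by (intro exI[of _ "Suc n"]) simp
next
  case (next_j l k j)
  then obtain n where "(l, k, j) = (next_index P \<eta> lsym lalg R ^^ n) (0, 0, 0)" by blast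
  from this[symmetric] show ?case using next_j by (intro exI[of _ "Suc n"]) simp
next
  case (next_k l k j)
  then obtain n where "(l, k, j) = (next_index P \<eta> lsym lalg R ^^ n) (0, 0, 0)" by blast
  from this[symmetric] show ?case using next_k by (intro exI[of _ "Suc n"]) simp
next
  case (next_l l k j)
  then obtain n where "(l, k, j) = (next_index P \<eta> lsym lalg R ^^ n) (0, 0, 0)" by blast
  from this[symmetric] show ?case using next_l by (intro exI[of _ "Suc n"]) simp
qed

text \<open>The orbit is increasing, so the predecessors of its \<open>n\<close>-th point are among its first \<open>n + 1\<close> points.\<close>

lemma finite_predecessors:
  assumes "q \<in> index_set P \<eta> lsym lalg R"
  shows "finite {q' \<in> index_set P \<eta> lsym lalg R. idx_le q' q}"
proof -
  let ?f = "\<lambda>n. (next_index P \<eta> lsym lalg R ^^ n) (0, 0, 0)"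
  have orbit: "\<exists>n. x = ?f n" if "x \<in> index_set P \<eta> lsym lalg R" for x
    using that index_set_in_orbit by (cases x) blast
  then obtain n where n: "q = ?f n" using assms by blast
  have "{q' \<in> index_set P \<eta> lsym lalg R. idx_le q' q} \<subseteq> ?f ` {..n}"
  proof
    fix q' assume q': "q' \<in> {q' \<in> index_set P \<eta> lsym lalg R. idx_le q' q}"
    then obtain m where m: "q' = ?f m" using orbit by blast
    have "m \<le> n"
    proof (rule ccontr)
      assume "\<not> m \<le> n"
      then have "idx_le (?f (Suc n)) (?f m)" by (intro orbit_mono) simp
      then have "idx_le (?f (Suc n)) (?f n)" using q' m n idx_le_trans by blast
      then show False by (simp add: not_next_index_le)
    qed
    then show "q' \<in> ?f ` {..n}" using m by blast
  qed
  then show ?thesis by (rule finite_subset) simp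
qed

lemma idx_rank_less:
  assumes Q: "Q = index_set P \<eta> lsym lalg R" and "q \<in> Q" "q' \<in> Q" "idx_le q q'" "q \<noteq> q'"
  shows "idx_rank Q q < idx_rank Q q'"
  unfolding idx_rank_def
proof (rule psubset_card_mono)
  show "finite {x \<in> Q. idx_le x q'}" using assms finite_predecessors by blast
  have "q' \<in> {x \<in> Q. idx_le x q'} - {x \<in> Q. idx_le x q}"
    using assms idx_le_refl idx_le_antisym by blast
  then show "{x \<in> Q. idx_le x q} \<subset> {x \<in> Q. idx_le x q'}"
    using assms(4) idx_le_trans by blast
qed

lemma inj_on_idx_rank: "inj_on (idx_rank (index_set P \<eta> lsym lalg R)) (index_set P \<eta> lsym lalg R)"
  by (rule inj_onI) (metis idx_le_total idx_rank_less less_irrefl)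

lemma level_start_in_index_set:
  assumes "(l', k, j) \<in> index_set P \<eta> lsym lalg R" and "l \<le> l'"
  shows "(l, 0, 0) \<in> index_set P \<eta> lsym lalg R"
  using assms
proof (induction rule: index_set.induct)
  case (next_l l' k j)
  show ?case
  proof (cases "l = l' + 1")
    case True
    then show ?thesis using index_set.next_l[OF next_l.hyps] by simp
  qed (use next_l.IH next_l.prems in simp)
qed (auto intro: index_set.start)

lemma level_start_if_le_l_sup:
  assumes "enat l0 \<le> l_sup (index_set P \<eta> lsym lalg R)"
  shows "(l0, 0, 0) \<in> index_set P \<eta> lsym lalg R"
proof (cases l0)
  case 0
  then show ?thesis by (simp add: index_set.start)
next
  case (Suc l')
  then have "enat l' < l_sup (index_set P \<eta> lsym lalg R)"
    using assms by (metis Suc_ile_eq)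
  then obtain l where "(l, 0, 0) \<in> index_set P \<eta> lsym lalg R" "l' < l"
    by (auto simp: l_sup_def less_SUP_iff)
  then show ?thesis using Suc level_start_in_index_set[of l 0 0 P \<eta> lsym lalg R l0] by simp
qed

lemma finite_below_level:
  assumes "(l0, 0, 0) \<in> index_set P \<eta> lsym lalg R"
  shows "finite {q \<in> index_set P \<eta> lsym lalg R. fst q < l0}"
  by (rule finite_subset[OF _ finite_predecessors[OF assms]]) auto

section \<open>Meshes of the algorithm\<close>

lemma conforming_mesh_card_ge_1:
  assumes "model_problem P" and "conforming_mesh (pde_dom P) \<T>"
  shows "1 \<le> card \<T>"
proof -
  have "pde_dom P \<noteq> {}"
    using assms(1) by (simp add: model_problem_def polyhedral_lipschitz_domain_def)
  then have "\<Union>(region ` \<T>) \<noteq> {}"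
    using assms(2) closure_subset by (fastforce simp: conforming_mesh_def)
  then have "\<T> \<noteq> {}" by auto
  moreover have "finite \<T>" using assms(2) by (simp add: conforming_mesh_def)
  ultimately show ?thesis by (simp add: Suc_leI card_gt_0_iff)
qed

lemma refinements_conforming:
  assumes "\<S> \<in> refinements \<Omega> \<T>" and "conforming_mesh \<Omega> \<T>"
  shows "conforming_mesh \<Omega> \<S>"
  using assms by induction (auto simp: is_refine_def conforming_refinement_def)

lemma aisfem_next_level:
  assumes R: "aisfem P m \<T>0 \<eta> \<Psi> \<delta> \<theta> Cmark lsym lalg R"
    and "(l, k, j) \<in> index_set P \<eta> lsym lalg R" and "1 \<le> k" and "1 \<le> j"
    and "stop_alg P \<eta> lsym lalg R l k j" and "stop_sym P \<eta> lsym R l k"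
  shows "marked R l \<subseteq> msh R l"
    and "is_refine (pde_dom P) (msh R l) (marked R l) (msh R (l + 1))"
    and "star R (l + 1) 0 = iter R (l + 1) 0 0" and "last_j R (l + 1) 0 = 0"
proof -
  have "quasi_minimal_doerfler \<eta> \<theta> Cmark (msh R l) (iter_last R l (last_k R l)) (marked R l) \<and>
      is_refine (pde_dom P) (msh R l) (marked R l) (msh R (l + 1)) \<and>
      iter R (l + 1) 0 0 = iter_last R l (last_k R l) \<and>
      star R (l + 1) 0 = iter_last R l (last_k R l) \<and> last_j R (l + 1) 0 = 0"
    using assms unfolding aisfem_def Let_def by blast
  then show "marked R l \<subseteq> msh R l"
    and "is_refine (pde_dom P) (msh R l) (marked R l) (msh R (l + 1))"
    and "star R (l + 1) 0 = iter R (l + 1) 0 0" and "last_j R (l + 1) 0 = 0"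
    by (simp_all add: quasi_minimal_doerfler_def doerfler_def)
qed

lemma aisfem_mesh_in_refinements:
  assumes R: "aisfem P m \<T>0 \<eta> \<Psi> \<delta> \<theta> Cmark lsym lalg R"
    and "(l, k, j) \<in> index_set P \<eta> lsym lalg R"
  shows "msh R l \<in> refinements (pde_dom P) \<T>0"
  using assms(2)
proof (induction rule: index_set.induct)
  case start
  then show ?case using R by (auto simp: aisfem_def Let_def intro: refinements.refl)
next
  case (next_l l k j)
  note next_level = aisfem_next_level[OF R next_l.hyps]
  show ?case using next_l.IH next_level(1,2) by (rule refinements.step)
qed auto

lemma aisfem_num_elements_ge_1:
  assumes "model_problem P" and "initial_mesh (pde_dom P) \<T>0"
    and "aisfem P m \<T>0 \<eta> \<Psi> \<delta> \<theta> Cmark lsym lalg R" and "q \<in> index_set P \<eta> lsym lalg R"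
  shows "1 \<le> num_elements R q"
proof -
  have "msh R (fst q) \<in> refinements (pde_dom P) \<T>0"
    using aisfem_mesh_in_refinements[OF assms(3)] assms(4) by (cases q) auto
  then have "conforming_mesh (pde_dom P) (msh R (fst q))"
    using assms(2) refinements_conforming by (auto simp: initial_mesh_def)
  then show ?thesis
    using conforming_mesh_card_ge_1[OF assms(1)] by (simp add: num_elements_def)
qed

section \<open>The quasi-error at the start of a level\<close>

text \<open>Stability on one mesh and the empty set of elements reads \<open>0 \<le> C\<^sub>s\<^sub>t\<^sub>a\<^sub>b \<parallel>v - w\<parallel>\<^sub>a\<close>. This is
  where the sign of the energy norm of a difference of discrete functions comes from; the real
  square root is defined, and negative, for negative \<open>a(v - w, v - w)\<close> as well.\<close>

lemma enorm_diff_nonneg: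
  assumes "A1_stability P m \<T>0 \<eta> Cstab" and "0 < Cstab"
    and "\<T> \<in> refinements (pde_dom P) \<T>0" and "v \<in> fe_space P m \<T>" and "w \<in> fe_space P m \<T>"
  shows "0 \<le> enorm P (v - w)"
proof -
  have "\<bar>est \<eta> \<T> {} v - est \<eta> \<T> {} w\<bar> \<le> Cstab * enorm P (v - w)"
    using assms refinements.refl unfolding A1_stability_def by blast
  then have "0 \<le> Cstab * enorm P (v - w)" by linarith
  then show ?thesis using assms(2) by (simp add: zero_le_mult_iff)
qed

text \<open>Comparing a function with itself, the contraction gives \<open>\<parallel>0\<parallel>\<^sub>a \<le> q\<^sub>s\<^sub>y\<^sub>m \<parallel>0\<parallel>\<^sub>a\<close>. Weak gradients are
  fixed only through a choice, so \<open>\<parallel>0\<parallel>\<^sub>a = 0\<close> is not immediate from the definition.\<close>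

lemma enorm_zero:
  assumes "zarantonello_contraction P m \<T>0 \<delta> qsym"
    and "A1_stability P m \<T>0 \<eta> Cstab" and "0 < Cstab"
    and T: "\<T> \<in> refinements (pde_dom P) \<T>0" and v: "v \<in> fe_space P m \<T>"
  shows "enorm P (\<lambda>_. 0) = 0"
proof -
  have "enorm P (zarantonello P m \<delta> \<T> v - zarantonello P m \<delta> \<T> v) \<le> qsym * enorm P (v - v)"
    using assms(1) T v unfolding zarantonello_contraction_def by blast
  then have "(1 - qsym) * enorm P (\<lambda>_. 0) \<le> 0" by (simp add: fun_diff_def algebra_simps)
  then have "enorm P (\<lambda>_. 0) \<le> 0"
    using assms(1) by (simp add: zarantonello_contraction_def mult_le_0_iff)
  moreover have "0 \<le> enorm P (\<lambda>_. 0)"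
    using enorm_diff_nonneg[OF assms(2,3) T v v] by (simp add: fun_diff_def)
  ultimately show ?thesis by simp
qed

lemma aisfem_level_start:
  assumes R: "aisfem P m \<T>0 \<eta> \<Psi> \<delta> \<theta> Cmark lsym lalg R"
    and "(l, k, j) \<in> index_set P \<eta> lsym lalg R"
  shows "star R l 0 = iter R l 0 0 \<and> last_j R l 0 = 0"
  using assms(2)
proof (induction rule: index_set.induct)
  case start
  then show ?case using R by (auto simp: aisfem_def Let_def)
next
  case (next_l l k j)
  note next_level = aisfem_next_level[OF R next_l.hyps]
  show ?case using next_level(3,4) by blast
qed auto

lemma quasi_error_first_step:
  assumes "zarantonello_contraction P m \<T>0 \<delta> qsym"
    and "A1_stability P m \<T>0 \<eta> Cstab" and "0 < Cstab"
    and R: "aisfem P m \<T>0 \<eta> \<Psi> \<delta> \<theta> Cmark lsym lalg R"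
    and l: "(l, 0, 0) \<in> index_set P \<eta> lsym lalg R"
  shows "quasi_error P \<eta> uex R (l, 0, 0) \<le> quasi_error P \<eta> uex R (l, 1, 0)"
proof -
  have l1: "(l, 1, 0) \<in> index_set P \<eta> lsym lalg R"
    using l by (rule index_set.enter_k)
  have T: "msh R l \<in> refinements (pde_dom P) \<T>0"
    using aisfem_mesh_in_refinements[OF R l] by simp
  have fe: "iter R l 0 0 \<in> fe_space P m (msh R l)" "iter R l 1 0 \<in> fe_space P m (msh R l)"
      "star R l 1 \<in> fe_space P m (msh R l)"
    using R l l1 unfolding aisfem_def Let_def by blast+
  have "iter R l 1 0 = iter_last R l 0"
    using R l1 unfolding aisfem_def Let_def by (metis diff_self_eq_0 order_refl)
  then have iter: "iter R l 1 0 = iter R l 0 0"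
    using aisfem_level_start[OF R l] by (simp add: iter_last_def)
  have "enorm P (star R l 0 - iter R l 0 0) = 0"
    using aisfem_level_start[OF R l] enorm_zero[OF assms(1-3) T fe(1)] by (simp add: fun_diff_def)
  moreover have "0 \<le> enorm P (star R l 1 - iter R l 1 0)"
    using enorm_diff_nonneg[OF assms(2,3) T fe(3,2)] .
  ultimately show ?thesis using iter by (simp add: quasi_error_def)
qed

text \<open>An error that does not decrease in the first step from \<open>(\<ell>\<^sub>0, 0, 0)\<close> cannot be positive there
  and contract with a constant \<open>C < 1\<close>. If it is not positive there, all later errors inherit the
  sign.\<close>

lemma linear_convergence_dichotomy:
  assumes lin: "full_linear_convergence Q \<Delta> Clin qlin l0" and Q: "Q = index_set P \<eta> lsym lalg R"
    and l0: "(l0, 0, 0) \<in> Q" and first: "\<Delta> (l0, 0, 0) \<le> \<Delta> (l0, 1, 0)"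
  obtains "1 \<le> Clin" | "\<And>q. q \<in> Q \<Longrightarrow> l0 \<le> fst q \<Longrightarrow> \<Delta> q \<le> 0"
proof (cases "0 < \<Delta> (l0, 0, 0)")
  case True
  let ?q = "(l0, 0, 0)" and ?q1 = "(l0, 1, 0)"
  have C: "0 < Clin" "0 < qlin" "qlin < 1"
    using lin by (auto simp: full_linear_convergence_def)
  have q1: "?q1 \<in> Q" using l0 index_set.enter_k unfolding Q by fastforce
  have "idx_rank Q ?q < idx_rank Q ?q1"
    using l0 q1 by (intro idx_rank_less[OF Q]) auto
  then have "\<Delta> ?q1 \<le> Clin * qlin ^ (idx_rank Q ?q1 - idx_rank Q ?q) * \<Delta> ?q"
    using lin l0 q1 by (fastforce simp: full_linear_convergence_def)
  also have "\<dots> \<le> Clin * 1 * \<Delta> ?q"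
    using C True by (intro mult_right_mono mult_left_mono power_le_one) auto
  finally have "\<Delta> ?q \<le> Clin * \<Delta> ?q" using first by simp
  then have "1 \<le> Clin" using True by simp
  then show ?thesis by (rule that(1))
next
  case False
  have "\<Delta> q \<le> 0" if q: "q \<in> Q" "l0 \<le> fst q" for q
  proof (cases "q = (l0, 0, 0)")
    case False': False
    have "idx_le (l0, 0, 0) q" using q(2) by (cases q) auto
    then have "idx_rank Q (l0, 0, 0) < idx_rank Q q"
      using q(1) l0 False' by (intro idx_rank_less[OF Q]) auto
    then have "\<Delta> q \<le> Clin * qlin ^ (idx_rank Q q - idx_rank Q (l0, 0, 0)) * \<Delta> (l0, 0, 0)"
      using lin q(1) l0 by (auto simp: full_linear_convergence_def)
    also have "\<dots> \<le> 0"
      using lin False by (intro mult_nonneg_nonpos) (auto simp: full_linear_convergence_def)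
    finally show ?thesis .
  qed (use False in simp)
  then show ?thesis by (rule that(2))
qed

section \<open>Rates with respect to degrees of freedom and cumulative cost\<close>

theorem corollary4p2:
  fixes P :: "'n::finite pde" and m l0 :: nat and \<T>0 :: "'n mesh"
    and \<eta> :: "'n estimator" and \<Psi> :: "'n solver" and uex :: "'n fn" and R :: "'n aisfem_output"
    and s \<delta> \<theta> Cmark lsym lalg lalg' lalgs qsym qalg qred Cstab Crel Clin qlin :: real
  assumes "0 < s" and "1 \<le> m"
    and "model_problem P" and "exact_solution P uex" and "initial_mesh (pde_dom P) \<T>0"
    and "0 < \<delta>" and "zarantonello_contraction P m \<T>0 \<delta> qsym"
    and "algebraic_solver P m \<T>0 \<Psi> qalg"
    and "0 < Cstab" and "0 < Crel" and "0 < qred" and "qred < 1"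
    and "estimator_nonneg P m \<T>0 \<eta>"
    and "A1_stability P m \<T>0 \<eta> Cstab"
    and "A2_reduction P m \<T>0 \<eta> qred"
    and "A3_reliability P m \<T>0 \<eta> uex Crel"
    and "0 < lalgs"
    and "0 < (qsym + 2 * (qalg / (1 - qalg)) * lalgs) / (1 - 2 * (qalg / (1 - qalg)) * lalgs)"
    and "(qsym + 2 * (qalg / (1 - qalg)) * lalgs) / (1 - 2 * (qalg / (1 - qalg)) * lalgs) < 1"
    and "0 < \<theta>" and "\<theta> \<le> 1" and "1 \<le> Cmark" and "0 < lsym" and "lsym \<le> 1"
    and "0 < lalg'" and "lalg' \<le> lalgs"
    and "linear_convergence_threshold P m \<T>0 \<eta> \<Psi> uex \<delta> \<theta> Cmark lsym lalg'"
    and "0 < lalg" and "lalg \<le> lalg'"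
    and "aisfem P m \<T>0 \<eta> \<Psi> \<delta> \<theta> Cmark lsym lalg R"
    and "full_linear_convergence (index_set P \<eta> lsym lalg R) (quasi_error P \<eta> uex R) Clin qlin l0"
  shows "let Q = index_set P \<eta> lsym lalg R;
             \<Delta> = quasi_error P \<eta> uex R;
             Q0 = {q \<in> Q. l0 \<le> fst q};
             M = (SUP q\<in>Q0. ennreal (num_elements R q powr s * \<Delta> q));
             W = (SUP q\<in>Q0. ennreal ((\<Sum>q' | q' \<in> Q0 \<and> idx_rank Q q' \<le> idx_rank Q q. num_elements R q') powr s * \<Delta> q))
         in M \<le> W \<and>
            W \<le> ennreal (Clin / (1 - qlin powr (1 / s)) powr s) * M \<and>
            ((SUP q\<in>Q. ennreal (num_elements R q powr s * \<Delta> q)) < \<infinity> \<longleftrightarrow>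
             (SUP q\<in>Q. ennreal ((\<Sum>q' | q' \<in> Q \<and> idx_rank Q q' \<le> idx_rank Q q. num_elements R q') powr s * \<Delta> q)) < \<infinity>)"
proof -
  define Q where "Q = index_set P \<eta> lsym lalg R"
  define \<Delta> where "\<Delta> = quasi_error P \<eta> uex R"
  define Q0 where "Q0 = {q \<in> Q. l0 \<le> fst q}"
  define r where "r = idx_rank Q"
  define N where "N = num_elements R"
  let ?M = "\<lambda>S. SUP q\<in>S. ennreal (N q powr s * \<Delta> q)"
  let ?W = "\<lambda>S. SUP q\<in>S. ennreal ((\<Sum>q' | q' \<in> S \<and> r q' \<le> r q. N q') powr s * \<Delta> q)"
  let ?K = "ennreal (Clin / (1 - qlin powr (1 / s)) powr s)"
  have lin: "full_linear_convergence Q \<Delta> Clin qlin l0"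
    using assms(31) by (simp add: Q_def \<Delta>_def)
  then have l0: "(l0, 0, 0) \<in> Q"
    unfolding Q_def by (intro level_start_if_le_l_sup) (simp add: full_linear_convergence_def)
  have sub: "Q0 \<subseteq> Q" by (auto simp: Q0_def)
  have inj: "inj_on r Q" unfolding r_def Q_def by (rule inj_on_idx_rank)
  have inj0: "inj_on r Q0" using inj sub by (rule inj_on_subset)
  have N1: "1 \<le> N q" if "q \<in> Q" for q
    unfolding N_def using that aisfem_num_elements_ge_1[OF assms(3,5,30)] by (simp add: Q_def)
  have N0: "0 \<le> N q" if "q \<in> Q" for q using N1[OF that] by linarith
  have MW0: "?M Q0 \<le> ?W Q0"
    using inj0 N0 sub \<open>0 < s\<close> by (intro weighted_size_le_weighted_cost) auto
  have MW: "?M Q \<le> ?W Q"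
    using inj N0 \<open>0 < s\<close> by (intro weighted_size_le_weighted_cost) auto
  have "\<Delta> (l0, 0, 0) \<le> \<Delta> (l0, 1, 0)"
    unfolding \<Delta>_def using l0 unfolding Q_def by (rule quasi_error_first_step[OF assms(7,14,9,30)])
  then consider "1 \<le> Clin" | "\<And>q. q \<in> Q \<Longrightarrow> l0 \<le> fst q \<Longrightarrow> \<Delta> q \<le> 0"
    using linear_convergence_dichotomy[OF lin Q_def l0] by blast
  then have WM0: "?W Q0 \<le> ?K * ?M Q0"
  proof cases
    case 1
    show ?thesis
    proof (rule weighted_cost_le_weighted_size[OF inj0])
      show "\<Delta> x \<le> Clin * qlin ^ (r x - r y) * \<Delta> y" if "x \<in> Q0" "y \<in> Q0" "r y < r x" for x y
        using lin that by (auto simp: full_linear_convergence_def r_def Q0_def)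
    qed (use 1 lin N0 sub \<open>0 < s\<close> in \<open>auto simp: full_linear_convergence_def\<close>)
  next
    case 2
    then have "(\<Sum>q' | q' \<in> Q0 \<and> r q' \<le> r q. N q') powr s * \<Delta> q \<le> 0" if "q \<in> Q0" for q
      using that by (intro mult_nonneg_nonpos) (auto simp: Q0_def)
    then have "?W Q0 \<le> 0" by (intro SUP_least) (simp add: ennreal_neg)
    then show ?thesis by simp
  qed
  have "?M Q < \<infinity> \<longleftrightarrow> ?W Q < \<infinity>"
  proof
    assume fin: "?M Q < \<infinity>"
    have "?M Q0 \<le> ?M Q" using sub by (intro SUP_subset_mono) auto
    then have "?K * ?M Q0 < \<infinity>"
      using fin by (auto simp: ennreal_mult_less_top)
    then have "?W Q0 < \<infinity>" using WM0 by (rule le_less_trans[rotated])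
    moreover have "finite (Q - Q0)"
      using finite_below_level[OF l0[unfolded Q_def]]
      by (rule finite_subset[rotated]) (auto simp: Q0_def Q_def)
    ultimately show "?W Q < \<infinity>"
      using inj N1 \<open>0 < s\<close> sub by (intro weighted_cost_finite_extend[of r Q N s Q0]) auto
  qed (use MW in \<open>rule le_less_trans\<close>)
  then show ?thesis
    using MW0 WM0 unfolding Let_def
    by (simp add: Q_def \<Delta>_def Q0_def r_def N_def)
qed

end
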